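(* Let $n\ge2$, $s\in(0,1)$, and let $p\in\left(1,\frac{n+2}{n-2}\right)$ if $n>2$, $p\in(1,+\infty)$ if $n=2$. Then all classical positive solutions of $$-\Delta u+(-\Delta)^su+u=u^p\ \text{ in }\mathbb{R}^n,\qquad \lim_{|x|\to+\infty}u(x)=0$$ are radially symmetric with respect to some point of $\mathbb{R}^n$.
   Context: The fractional Laplacian is $(-\Delta)^su(x)=c_{n,s}\,\mathrm{P.V.}\int_{\mathbb{R}^n}\frac{u(x)-u(y)}{|x-y|^{n+2s}}\,dy$, where $c_{n,s}>0$ is a normalization constant (its explicit value plays no role). A classical positive solution is a function $u\in C^2(\mathbb{R}^n)$ with $u>0$ in $\mathbb{R}^n$ satisfying the equation pointwise. *)

theory Defs
  imports "HOL-Analysis.Analysis"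
begin

definition C2 :: "('a::euclidean_space \<Rightarrow> real) \<Rightarrow> bool" where
  "C2 u \<longleftrightarrow>
     (\<exists>(u' :: 'a \<Rightarrow> 'a \<Rightarrow>\<^sub>L real) (u'' :: 'a \<Rightarrow> 'a \<Rightarrow>\<^sub>L 'a \<Rightarrow>\<^sub>L real).
        (\<forall>x. (u has_derivative blinfun_apply (u' x)) (at x)) \<and>
        (\<forall>x. (u' has_derivative blinfun_apply (u'' x)) (at x)) \<and>
        continuous_on UNIV u'')"

definition partial_deriv :: "'a::euclidean_space \<Rightarrow> ('a \<Rightarrow> real) \<Rightarrow> 'a \<Rightarrow> real" where
  "partial_deriv b u x = deriv (\<lambda>t. u (x + t *\<^sub>R b)) 0"

definition laplacian :: "('a::euclidean_space \<Rightarrow> real) \<Rightarrow> 'a \<Rightarrow> real" where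
  "laplacian u x = (\<Sum>b\<in>Basis. partial_deriv b (partial_deriv b u) x)"

definition frac_kernel :: "real \<Rightarrow> ('a::euclidean_space \<Rightarrow> real) \<Rightarrow> 'a \<Rightarrow> 'a \<Rightarrow> real" where
  "frac_kernel s u x y = (u x - u y) / norm (x - y) powr (real DIM('a) + 2 * s)"

text \<open>
  \<open>has_frac_laplacian c s u L x\<close>: the fractional Laplacian of order \<open>s\<close> of \<open>u\<close> at \<open>x\<close>, with
  normalization constant \<open>c\<close>, is well defined and equals \<open>L\<close>.  The principal value is the limit
  of the absolutely convergent integrals over the complements of balls around \<open>x\<close>.  The
  integrability clause and the relational form rule out the default values which the Bochner
  integral and a limit operator would return when the principal value does not exist.
  The constant \<open>c\<close> stands for \<open>c\<^sub>n\<^sub>,\<^sub>s\<close> and is kept as a parameter, as its value depends on conventions.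
\<close>

definition has_frac_laplacian ::
    "real \<Rightarrow> real \<Rightarrow> ('a::euclidean_space \<Rightarrow> real) \<Rightarrow> real \<Rightarrow> 'a \<Rightarrow> bool" where
  "has_frac_laplacian c s u L x \<longleftrightarrow>
     (\<forall>\<epsilon>>0. set_integrable lborel (- ball x \<epsilon>) (frac_kernel s u x)) \<and>
     (\<exists>I. ((\<lambda>\<epsilon>. LINT y:- ball x \<epsilon>|lborel. frac_kernel s u x y) \<longlongrightarrow> I) (at_right 0) \<and>
          L = c * I)"

text \<open>Classical positive solutions of \<open>-\<Delta>u + (-\<Delta>)\<^sup>s u + u = u\<^sup>p\<close> on the whole space.\<close>

definition classical_positive_solution ::
    "real \<Rightarrow> real \<Rightarrow> real \<Rightarrow> ('a::euclidean_space \<Rightarrow> real) \<Rightarrow> bool" where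
  "classical_positive_solution c s p u \<longleftrightarrow>
     C2 u \<and> (\<forall>x. u x > 0) \<and>
     (\<forall>x. \<exists>L. has_frac_laplacian c s u L x \<and> - laplacian u x + L + u x = u x powr p)"

definition radially_symmetric_about :: "'a::euclidean_space \<Rightarrow> ('a \<Rightarrow> real) \<Rightarrow> bool" where
  "radially_symmetric_about x0 u \<longleftrightarrow> (\<exists>g :: real \<Rightarrow> real. \<forall>x. u x = g (norm (x - x0)))"

end

theory Submission
  imports Defs
begin

text \<open>
  Moving planes.  For a unit vector \<open>e\<close> let \<open>R\<close> be the reflection in \<open>{y. y \<bullet> e = l}\<close> and
  \<open>w = u \<circ> R - u\<close>.  At a negative minimum \<open>x\<close> of \<open>w\<close> over the half space \<open>{y. l \<le> y \<bullet> e}\<close>, at distance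
  \<open>d\<close> from the plane, the Laplacian of \<open>w\<close> is nonnegative and the antisymmetry of \<open>w\<close> bounds its
  fractional Laplacian by \<open>C w(x) d powr (- 2 * s)\<close>.  The equation then forces
  \<open>1 + C d powr (- 2 * s) \<le> p * u x powr (p - 1)\<close>, so, uniformly in \<open>e\<close> and \<open>l\<close>, such minima stay in
  a bounded set (as \<open>u\<close> decays) and away from the plane (as \<open>u\<close> is bounded).  Hence \<open>w \<ge> 0\<close>
  for large \<open>l\<close>, and at the critical position the minima accumulate at an interior zero of \<open>w\<close>;
  there the nonlocal term forces \<open>w = 0\<close> everywhere.  Thus every direction has a symmetry
  plane, and these planes meet in a single point.
\<close>

section \<open>Lebesgue measure under orthogonal maps\<close>

text \<open>
  Evaluating \<open>\<integral>\<integral> 1\<^sub>A(f x + y) 1\<^sub>B(y) dx dy\<close> in both orders for the unit ball \<open>B\<close> gives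
  \<open>|f\<inverse> A| |B|\<close> and \<open>|A| |B|\<close>, because \<open>f\<close> preserves \<open>B\<close>.  The orthogonal change of variables
  of the library is restricted to well-ordered index types.
\<close>

lemma distr_lborel_orthogonal_transformation:
  fixes f :: "'a::euclidean_space \<Rightarrow> 'a"
  assumes f: "orthogonal_transformation f"
  shows "distr lborel borel f = lborel"
proof -
  define g where "g = inv f"
  have fg: "f (g y) = y" and gf: "g (f y) = y" for y
    using orthogonal_transformation_bij[OF f] by (auto simp: g_def bij_def surj_f_inv_f)
  have lin: "linear f"
    by (rule orthogonal_transformation_linear[OF f])
  have [measurable]: "f \<in> borel_measurable borel"
    by (intro borel_measurable_continuous_onI linear_continuous_on)
       (use lin in \<open>simp add: linear_conv_bounded_linear\<close>)
  have shift: "(\<integral>\<^sup>+x. h (x + a) \<partial>lborel) = (\<integral>\<^sup>+x. h x \<partial>lborel)"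
    if [measurable]: "h \<in> borel_measurable borel" for h :: "'a \<Rightarrow> ennreal" and a
    using nn_integral_distr[of "(+) a" lborel borel h]
    by (simp add: lborel_distr_plus add.commute)
  define B :: "'a set" where "B = ball 0 1"
  have [measurable]: "B \<in> sets borel" by (simp add: B_def)
  have B_fin: "emeasure lborel B \<noteq> 0" "emeasure lborel B \<noteq> \<infinity>"
    using content_ball_pos[of 1 "0::'a"] emeasure_lborel_ball_finite[of "0::'a" 1]
    by (auto simp: B_def measure_def)
  have "emeasure lborel (f -` A) = emeasure lborel A" if [measurable]: "A \<in> sets borel" for A
  proof -
    have [measurable]: "f -` A \<in> sets borel"
      using measurable_sets[of f borel borel A] by simp
    have "emeasure lborel (f -` A) * emeasure lborel B
        = (\<integral>\<^sup>+y. (\<integral>\<^sup>+x. indicator A (f x) * indicator B y \<partial>lborel) \<partial>lborel)"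
    proof -
      have "(\<integral>\<^sup>+x. indicator A (f x) \<partial>lborel) = emeasure lborel (f -` A)"
        by (simp flip: indicator_vimage nn_integral_indicator)
      then show ?thesis
        by (simp add: nn_integral_multc nn_integral_cmult)
    qed
    also have "\<dots> = (\<integral>\<^sup>+y. (\<integral>\<^sup>+x. indicator A (f x + y) * indicator B y \<partial>lborel) \<partial>lborel)"
    proof (rule nn_integral_cong)
      fix y :: 'a
      \<comment> \<open>A translation by \<open>y\<close> outside \<open>f\<close> is a translation
        by \<open>g y\<close> inside it, so only translation invariance in \<open>x\<close> is
        used.\<close>
      have "f x + y = f (x + g y)" for x
        using lin by (simp add: linear_add fg)
      then show "(\<integral>\<^sup>+x. indicator A (f x) * indicator B y \<partial>lborel)
          = (\<integral>\<^sup>+x. indicator A (f x + y) * indicator B y \<partial>lborel)"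
        using shift[of "\<lambda>x. indicator A (f x) * indicator B y" "g y"] by simp
    qed
    also have "\<dots> = (\<integral>\<^sup>+x. (\<integral>\<^sup>+y. indicator A (f x + y) * indicator B y \<partial>lborel) \<partial>lborel)"
      by (rule lborel_pair.Fubini') measurable
    also have "\<dots> = (\<integral>\<^sup>+x. (\<integral>\<^sup>+y. indicator A y * indicator B (y - f x) \<partial>lborel) \<partial>lborel)"
    proof (rule nn_integral_cong)
      fix x :: 'a
      show "(\<integral>\<^sup>+y. indicator A (f x + y) * indicator B y \<partial>lborel)
          = (\<integral>\<^sup>+y. indicator A y * indicator B (y - f x) \<partial>lborel)"
        using shift[of "\<lambda>y. indicator A y * indicator B (y - f x)" "f x"] by (simp add: add.commute)
    qed
    also have "\<dots> = (\<integral>\<^sup>+y. (\<integral>\<^sup>+x. indicator A y * indicator B (y - f x) \<partial>lborel) \<partial>lborel)"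
      by (rule lborel_pair.Fubini') measurable
    also have "\<dots> = (\<integral>\<^sup>+y. indicator A y * emeasure lborel B \<partial>lborel)"
    proof (rule nn_integral_cong)
      fix y :: 'a
      have "norm (y - f (x + g y)) = norm x" for x
        using lin orthogonal_transformation_norm[OF f, of x] by (simp add: linear_add fg)
      then have "(\<integral>\<^sup>+x. indicator B (y - f x) \<partial>lborel) = emeasure lborel B"
        using shift[of "\<lambda>x. indicator B (y - f x)" "g y"]
        by (simp add: B_def indicator_def flip: nn_integral_indicator)
      then show "(\<integral>\<^sup>+x. indicator A y * indicator B (y - f x) \<partial>lborel) = indicator A y * emeasure lborel B"
        by (simp add: nn_integral_cmult)
    qed
    also have "\<dots> = emeasure lborel A * emeasure lborel B"
      by (simp add: nn_integral_multc)
    finally show ?thesis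
      using B_fin by (auto simp: mult.commute[of _ "emeasure lborel B"] ennreal_mult_cancel_left)
  qed
  then show ?thesis
    by (intro measure_eqI) (simp_all add: emeasure_distr)
qed

section \<open>Reflections in hyperplanes\<close>

definition hyper_reflection :: "'a::euclidean_space \<Rightarrow> real \<Rightarrow> 'a \<Rightarrow> 'a" where
  "hyper_reflection e l x = x + (2 * (l - x \<bullet> e)) *\<^sub>R e"

context
  fixes e :: "'a::euclidean_space"
  assumes e: "norm e = 1"
begin

lemma inner_unit_self: "e \<bullet> e = 1"
  using e by (simp add: dot_square_norm)

lemma hyper_reflection_inner: "hyper_reflection e l x \<bullet> e = 2 * l - x \<bullet> e"
  using inner_unit_self by (simp add: hyper_reflection_def algebra_simps)

lemma hyper_reflection_involution [simp]: "hyper_reflection e l (hyper_reflection e l x) = x"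
  by (simp add: hyper_reflection_def[of e l "hyper_reflection e l x"] hyper_reflection_inner)
     (simp add: hyper_reflection_def algebra_simps)

lemma orthogonal_transformation_hyper_reflection: "orthogonal_transformation (hyper_reflection e 0)"
  unfolding orthogonal_transformation_def
proof
  show "linear (hyper_reflection e 0)"
    by (rule linearI) (simp_all add: hyper_reflection_def algebra_simps)
  show "\<forall>v w. hyper_reflection e 0 v \<bullet> hyper_reflection e 0 w = v \<bullet> w"
    using inner_unit_self by (simp add: hyper_reflection_def algebra_simps inner_commute)
qed

text \<open>Splits the affine reflection into an orthogonal map and a translation; isometry and
  invariance of Lebesgue measure are inherited from these two pieces.\<close>

lemma hyper_reflection_conv_linear: "hyper_reflection e l x = (2 * l) *\<^sub>R e + hyper_reflection e 0 x"
  by (simp add: hyper_reflection_def algebra_simps)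

lemma norm_hyper_reflection_diff: "norm (hyper_reflection e l x - hyper_reflection e l y) = norm (x - y)"
  using orthogonal_transformation_norm[OF orthogonal_transformation_hyper_reflection, of "x - y"]
    linear_diff[OF orthogonal_transformation_linear[OF orthogonal_transformation_hyper_reflection]]
  by (simp add: hyper_reflection_conv_linear[of l])

text \<open>The correction is four times the product of the signed distances to the plane. Its sign
  for two points on the same side drives every kernel comparison below.\<close>

lemma norm_diff_hyper_reflection:
  "(norm (x - hyper_reflection e l y))\<^sup>2 = (norm (x - y))\<^sup>2 + 4 * (x \<bullet> e - l) * (y \<bullet> e - l)"
  using inner_unit_self
  by (simp add: hyper_reflection_def power2_norm_eq_inner algebra_simps inner_commute)

lemma norm_diff_le_hyper_reflection:
  assumes "l \<le> x \<bullet> e" "l \<le> y \<bullet> e"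
  shows "norm (x - y) \<le> norm (x - hyper_reflection e l y)"
  by (rule power2_le_imp_le) (use assms in \<open>auto simp: norm_diff_hyper_reflection\<close>)

lemma norm_diff_less_hyper_reflection:
  assumes "l < x \<bullet> e" "l < y \<bullet> e"
  shows "norm (x - y) < norm (x - hyper_reflection e l y)"
  by (rule power2_less_imp_less) (use assms in \<open>auto simp: norm_diff_hyper_reflection\<close>)

text \<open>The mirror point lies on the far side of the plane, so the segment to it must cross the
  plane. This keeps the reflected kernel away from its singularity.\<close>

lemma inner_le_norm_diff_hyper_reflection:
  assumes "l \<le> y \<bullet> e"
  shows "x \<bullet> e - l \<le> norm (x - hyper_reflection e l y)"
  using Cauchy_Schwarz_ineq2[of "x - hyper_reflection e l y" e] assms e
  by (simp add: inner_diff_left hyper_reflection_inner)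

lemma continuous_on_hyper_reflection [continuous_intros]:
  "continuous_on A f \<Longrightarrow> continuous_on A (\<lambda>x. hyper_reflection e l (f x))"
  unfolding hyper_reflection_def by (intro continuous_intros)

lemma borel_measurable_hyper_reflection [measurable]: "hyper_reflection e l \<in> borel_measurable borel"
  by (intro borel_measurable_continuous_onI continuous_intros)

lemma distr_lborel_hyper_reflection: "distr lborel borel (hyper_reflection e l) = lborel"
proof -
  have "distr lborel borel (hyper_reflection e l)
      = distr (distr lborel borel (hyper_reflection e 0)) borel ((+) ((2 * l) *\<^sub>R e))"
    by (subst distr_distr) (auto simp: hyper_reflection_conv_linear[of l] comp_def intro!: distr_cong)
  then show ?thesis
    by (simp add: distr_lborel_orthogonal_transformation orthogonal_transformation_hyper_reflection
        lborel_distr_plus)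
qed

lemma lborel_integral_hyper_reflection:
  fixes f :: "'a \<Rightarrow> real"
  assumes "f \<in> borel_measurable borel"
  shows "(\<integral>y. f (hyper_reflection e l y) \<partial>lborel) = (\<integral>y. f y \<partial>lborel)"
  using integral_distr[of "hyper_reflection e l" lborel borel f] assms
  by (simp add: distr_lborel_hyper_reflection)

lemma lborel_integrable_hyper_reflection:
  fixes f :: "'a \<Rightarrow> real"
  assumes "integrable lborel f"
  shows "integrable lborel (\<lambda>y. f (hyper_reflection e l y))"
  using integrable_distr[of "hyper_reflection e l" lborel borel f] assms
  by (simp add: distr_lborel_hyper_reflection)

end

section \<open>Both operators at a minimum of the reflected difference\<close>

text \<open>If \<open>D < 0\<close>, then \<open>f'\<close> is negative just to the right of its
  zero \<open>a\<close>, and the mean value theorem makes \<open>f\<close> drop below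
  \<open>f a\<close>. This works although \<open>f'\<close> is assumed differentiable at
  \<open>a\<close> only.\<close>

lemma second_derivative_nonneg_at_local_min:
  fixes f :: "real \<Rightarrow> real"
  assumes "\<And>t. (f has_real_derivative f' t) (at t)"
    and f'': "(f' has_real_derivative D) (at a)"
    and "0 < d" and min: "\<And>t. \<bar>t - a\<bar> < d \<Longrightarrow> f a \<le> f t"
  shows "D \<ge> 0"
proof (rule ccontr)
  assume "\<not> D \<ge> 0"
  have "f' a = 0"
    using DERIV_local_min[OF assms(1) assms(3)] min by (simp add: abs_minus_commute)
  obtain r where r: "r > 0" "\<And>h. 0 < h \<Longrightarrow> h < r \<Longrightarrow> f' (a + h) < f' a"
    using DERIV_neg_dec_right[OF f''] \<open>\<not> D \<ge> 0\<close> by force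
  define b where "b = a + min d r / 2"
  have "a < b" "b - a < d" "b - a < r"
    using \<open>0 < d\<close> r(1) by (auto simp: b_def min_def)
  then obtain z where z: "a < z" "z < b" "f b - f a = (b - a) * f' z"
    using MVT2[of a b f f'] assms(1) by blast
  then have "f' z < 0"
    using r(2)[of "z - a"] \<open>f' a = 0\<close> \<open>b - a < r\<close> by simp
  then have "f b < f a"
    using z \<open>a < b\<close> by (smt (verit) mult_pos_neg)
  then show False
    using min[of b] \<open>a < b\<close> \<open>b - a < d\<close> by simp
qed

text \<open>Expand \<open>f b\<close> in the basis; orthonormality of the rows of the matrix of
  \<open>f\<close> (\<open>orth\<close>) collapses the double sum. Used to recover a Laplacian from
  second derivatives along a reflected basis.\<close>

lemma trace_orthogonal_transformation:
  fixes B :: "'a::euclidean_space \<Rightarrow> 'a \<Rightarrow> real" and f :: "'a \<Rightarrow> 'a"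
  assumes f: "orthogonal_transformation f" and B: "bilinear B"
  shows "(\<Sum>b\<in>Basis. B (f b) (f b)) = (\<Sum>b\<in>Basis. B b b)"
proof -
  interpret B: bounded_bilinear B
    using B by (simp add: bilinear_conv_bounded_bilinear)
  have orth: "(\<Sum>b\<in>Basis. (f b \<bullet> i) * (f b \<bullet> j)) = i \<bullet> j" for i j :: 'a
  proof -
    define g where "g = inv f"
    have g: "orthogonal_transformation g" and fg: "f (g x) = x" for x
      using orthogonal_transformation_inv[OF f] orthogonal_transformation_bij[OF f]
      by (auto simp: g_def bij_def surj_f_inv_f)
    have "f b \<bullet> i = b \<bullet> g i" for b i
      using f fg unfolding orthogonal_transformation_def by metis
    then have "(\<Sum>b\<in>Basis. (f b \<bullet> i) * (f b \<bullet> j)) = g i \<bullet> g j"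
      by (simp add: euclidean_inner[of "g i" "g j"] inner_commute)
    then show ?thesis
      using g unfolding orthogonal_transformation_def by metis
  qed
  have "B (f b) (f b) = (\<Sum>i\<in>Basis. \<Sum>j\<in>Basis. ((f b \<bullet> i) * (f b \<bullet> j)) * B j i)" for b
  proof -
    have "B (f b) (f b) = B (\<Sum>i\<in>Basis. (f b \<bullet> i) *\<^sub>R i) (\<Sum>j\<in>Basis. (f b \<bullet> j) *\<^sub>R j)"
      by (simp only: euclidean_representation)
    then show ?thesis
      by (simp add: B.sum_left B.sum_right B.scaleR_left B.scaleR_right mult.assoc)
         (simp add: sum_distrib_left)
  qed
  then have "(\<Sum>b\<in>Basis. B (f b) (f b))
      = (\<Sum>b\<in>Basis. \<Sum>i\<in>Basis. \<Sum>j\<in>Basis. ((f b \<bullet> i) * (f b \<bullet> j)) * B j i)"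
    by simp
  also have "\<dots> = (\<Sum>i\<in>Basis. \<Sum>b\<in>Basis. \<Sum>j\<in>Basis. ((f b \<bullet> i) * (f b \<bullet> j)) * B j i)"
    by (rule sum.swap)
  also have "\<dots> = (\<Sum>i\<in>Basis. \<Sum>j\<in>Basis. \<Sum>b\<in>Basis. ((f b \<bullet> i) * (f b \<bullet> j)) * B j i)"
    by (intro sum.cong refl sum.swap)
  also have "\<dots> = (\<Sum>i\<in>Basis. \<Sum>j\<in>Basis. (\<Sum>b\<in>Basis. (f b \<bullet> i) * (f b \<bullet> j)) * B j i)"
    by (simp add: sum_distrib_right)
  also have "\<dots> = (\<Sum>i\<in>Basis. B i i)"
    by (simp add: orth inner_Basis if_distrib if_distribR cong: if_cong)
  finally show ?thesis .
qed

lemma has_real_derivative_along_line: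
  fixes f :: "'a::euclidean_space \<Rightarrow> real"
  assumes "(f has_derivative f') (at (x + t *\<^sub>R b))"
  shows "((\<lambda>t. f (x + t *\<^sub>R b)) has_real_derivative f' b) (at t)"
proof -
  have "((\<lambda>t. x + t *\<^sub>R b) has_derivative (\<lambda>h. h *\<^sub>R b)) (at t)"
    by (auto intro!: derivative_eq_intros)
  then have "((\<lambda>t. f (x + t *\<^sub>R b)) has_derivative (\<lambda>h. f' (h *\<^sub>R b))) (at t)"
    using has_derivative_compose assms by blast
  moreover have "(\<lambda>h. f' (h *\<^sub>R b)) = (\<lambda>h. f' b * h)"
    using has_derivative_linear[OF assms] by (auto simp: linear_scale)
  ultimately show ?thesis
    by (simp add: has_field_derivative_def)
qed

lemma has_derivative_blinfun_apply_const:
  assumes "(f has_derivative blinfun_apply F) (at x)"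
  shows "((\<lambda>y. blinfun_apply (f y) v) has_derivative (\<lambda>h. blinfun_apply (blinfun_apply F h) v)) (at x)"
  using bounded_linear.has_derivative[OF blinfun.bounded_linear_left assms] .

text \<open>Along each axis \<open>b\<close> the reflected difference has a local minimum, hence a
  nonnegative second derivative. The mirrored line runs in direction \<open>f b\<close>, with
  \<open>f\<close> the linear part of the reflection, and the trace of the Hessian is invariant
  under \<open>f\<close>.\<close>

lemma laplacian_reflection_ge_at_local_min:
  fixes u :: "'a::euclidean_space \<Rightarrow> real"
  assumes e: "norm e = 1" and "C2 u" and "0 < d"
    and min: "\<And>y. y \<in> ball x d \<Longrightarrow>
      u (hyper_reflection e l x) - u x \<le> u (hyper_reflection e l y) - u y"
  shows "laplacian u x \<le> laplacian u (hyper_reflection e l x)"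
proof -
  obtain u' :: "'a \<Rightarrow> 'a \<Rightarrow>\<^sub>L real" and u'' :: "'a \<Rightarrow> 'a \<Rightarrow>\<^sub>L 'a \<Rightarrow>\<^sub>L real"
    where u': "\<And>x. (u has_derivative blinfun_apply (u' x)) (at x)"
      and u'': "\<And>x. (u' has_derivative blinfun_apply (u'' x)) (at x)"
    using \<open>C2 u\<close> unfolding C2_def by blast
  have deriv1: "((\<lambda>t. u (y + t *\<^sub>R b)) has_real_derivative u' (y + t *\<^sub>R b) b) (at t)" for y b t
    by (rule has_real_derivative_along_line) (rule u')
  have deriv2: "((\<lambda>t. u' (y + t *\<^sub>R b) b) has_real_derivative u'' (y + t *\<^sub>R b) b b) (at t)" for y b t
    by (rule has_real_derivative_along_line[where f = "\<lambda>y. u' y b"])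
       (rule has_derivative_blinfun_apply_const, rule u'')
  have "partial_deriv b u = (\<lambda>y. u' y b)" for b
    using deriv1[where t = 0] by (auto simp: partial_deriv_def DERIV_imp_deriv)
  then have "partial_deriv b (partial_deriv b u) y = u'' y b b" for b y
    using deriv2[where t = 0] by (auto simp: partial_deriv_def DERIV_imp_deriv)
  then have lap: "laplacian u y = (\<Sum>b\<in>Basis. u'' y b b)" for y
    by (simp add: laplacian_def)
  define f where "f = hyper_reflection e 0"
  have f: "orthogonal_transformation f"
    unfolding f_def by (rule orthogonal_transformation_hyper_reflection[OF e])
  define z where "z = hyper_reflection e l x"
  have refl: "hyper_reflection e l (x + t *\<^sub>R b) = z + t *\<^sub>R f b" for t b
    using orthogonal_transformation_linear[OF f]
    by (simp add: z_def hyper_reflection_conv_linear[OF e, of l] linear_add linear_scale flip: f_def)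
  have "u'' x b b \<le> u'' z (f b) (f b)" if "b \<in> Basis" for b
  proof -
    have "0 \<le> u'' z (f b) (f b) - u'' x b b"
    proof (rule second_derivative_nonneg_at_local_min[OF _ _ \<open>0 < d\<close>])
      show "((\<lambda>t. u (z + t *\<^sub>R f b) - u (x + t *\<^sub>R b)) has_real_derivative
          u' (z + t *\<^sub>R f b) (f b) - u' (x + t *\<^sub>R b) b) (at t)" for t
        by (intro DERIV_diff deriv1)
      show "((\<lambda>t. u' (z + t *\<^sub>R f b) (f b) - u' (x + t *\<^sub>R b) b) has_real_derivative
          u'' z (f b) (f b) - u'' x b b) (at 0)"
        using DERIV_diff[OF deriv2[where t = 0] deriv2[where t = 0]] by simp
      show "u (z + 0 *\<^sub>R f b) - u (x + 0 *\<^sub>R b) \<le> u (z + t *\<^sub>R f b) - u (x + t *\<^sub>R b)"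
        if "\<bar>t - 0\<bar> < d" for t
        using min[of "x + t *\<^sub>R b"] that \<open>b \<in> Basis\<close> by (simp add: refl dist_norm z_def)
    qed
    then show ?thesis by simp
  qed
  then have "laplacian u x \<le> (\<Sum>b\<in>Basis. u'' z (f b) (f b))"
    unfolding lap by (rule sum_mono)
  also have "\<dots> = laplacian u z"
    unfolding lap
  proof (rule trace_orthogonal_transformation[OF f, where B = "\<lambda>v w. u'' z v w"])
    show "bilinear (\<lambda>v w. u'' z v w)"
      by (simp add: bilinear_def linear_iff blinfun.bilinear_simps)
  qed
  finally show ?thesis
    by (simp add: z_def)
qed

section \<open>The fractional Laplacian at a minimum\<close>

text \<open>
  Averaging the truncated integrand with its mirror image turns the kernel into the form
  \<open>2 w(x) K(x - Ry) + (w(x) - w(y)) (K(x - y) - K(x - Ry))\<close> on the half space, both terms of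
  which are nonpositive.  The mirror image of the truncation ball is not removed; it contributes
  at most \<open>M |ball x \<epsilon>|\<close>, which vanishes in the limit.
\<close>

lemma frac_laplacian_reflection_le:
  fixes u :: "'a::euclidean_space \<Rightarrow> real" and s :: real
  defines "N \<equiv> \<lambda>v::'a. norm v powr (real DIM('a) + 2 * s)"
  assumes e: "norm e = 1" and s: "0 < s"
    and meas: "u \<in> borel_measurable borel" and bdd: "\<And>y. \<bar>u y\<bar> \<le> W"
    and I1: "has_frac_laplacian 1 s u I1 x"
    and I2: "has_frac_laplacian 1 s u I2 (hyper_reflection e l x)"
  defines "w \<equiv> \<lambda>y. u (hyper_reflection e l y) - u y"
  assumes x: "l < x \<bullet> e" and wx: "w x \<le> 0"
    and min: "\<And>y. l \<le> y \<bullet> e \<Longrightarrow> w x \<le> w y"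
    and \<kappa>: "0 \<le> \<kappa>" and ball: "\<And>y. y \<in> ball z r \<Longrightarrow> l < y \<bullet> e"
    and key: "\<And>y. y \<in> ball z r \<Longrightarrow>
      2 * w x / N (x - hyper_reflection e l y)
        + (w x - w y) * (1 / N (x - y) - 1 / N (x - hyper_reflection e l y)) \<le> - \<kappa>"
  shows "I2 - I1 \<le> - \<kappa> * measure lborel (ball z r)"
proof -
  define R where "R = hyper_reflection e l"
  have RR [simp]: "R (R y) = y" for y
    by (simp add: R_def hyper_reflection_involution[OF e])
  have Re: "R y \<bullet> e = 2 * l - y \<bullet> e" for y
    by (simp add: R_def hyper_reflection_inner[OF e])
  have normR: "norm (R a - R b) = norm (a - b)" for a b
    by (simp add: R_def norm_hyper_reflection_diff[OF e])
  have wR: "w (R y) = - w y" for y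
    by (simp add: w_def flip: R_def)
  note [measurable] = meas borel_measurable_hyper_reflection[OF e, of l, folded R_def]
  define d where "d = x \<bullet> e - l"
  have "0 < d" using x by (simp add: d_def)
  have N_nonneg: "0 \<le> N v" for v by (simp add: N_def)
  \<comment> \<open>Numerator at most \<open>4 * W\<close>, distance to the mirror point at least
    \<open>d\<close>; the extra \<open>\<kappa>\<close> covers a possible overlap of
    \<open>ball x \<epsilon>\<close> with \<open>ball z r\<close>.\<close>
  define M where "M = \<kappa> + 4 * W / d powr (real DIM('a) + 2 * s)"
  have "0 \<le> W" using bdd[of x] by simp
  then have "0 \<le> M" using \<kappa> by (simp add: M_def)
  define f where "f \<epsilon> y = indicat_real (- ball x \<epsilon>) y * ((w x - w y) / N (x - y))" for \<epsilon> y
  \<comment> \<open>The majorant: \<open>M\<close> pays for the unremoved mirror image of the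
    truncation ball, and \<open>- \<kappa>\<close> records the gain assumed on
    \<open>ball z r\<close>.\<close>
  define G where "G \<epsilon> y = M * indicat_real (ball x \<epsilon>) y - \<kappa> * indicat_real (ball z r) y" for \<epsilon> y
  let ?J = "\<lambda>\<epsilon>. (LINT y:- ball (R x) \<epsilon>|lborel. frac_kernel s u (R x) y)
      - (LINT y:- ball x \<epsilon>|lborel. frac_kernel s u x y)"
  \<comment> \<open>Substituting \<open>R\<close> in the integral around \<open>R x\<close> brings
    both truncated integrals to the same centre \<open>x\<close>.\<close>
  have J: "integrable lborel (f \<epsilon>)" "?J \<epsilon> = (\<integral>y. f \<epsilon> y \<partial>lborel)" if "0 < \<epsilon>" for \<epsilon>
  proof -
    define f1 where "f1 y = indicat_real (- ball x \<epsilon>) y * ((u x - u y) / N (x - y))" for y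
    define f2 where "f2 y = indicat_real (- ball (R x) \<epsilon>) y * ((u (R x) - u y) / N (R x - y))" for y
    have "integrable lborel f1" and i2: "integrable lborel f2"
      using I1 I2 \<open>0 < \<epsilon>\<close>
      by (auto simp: has_frac_laplacian_def set_integrable_def frac_kernel_def f1_def[abs_def]
          f2_def[abs_def] N_def R_def)
    moreover have "integrable lborel (\<lambda>y. f2 (R y))"
      unfolding R_def by (rule lborel_integrable_hyper_reflection[OF e i2])
    moreover have f_eq: "f \<epsilon> = (\<lambda>y. f2 (R y) - f1 y)"
      by (auto simp: fun_eq_iff f_def f1_def f2_def w_def N_def normR indicator_def dist_norm
          diff_divide_distrib simp flip: R_def)
    ultimately show "integrable lborel (f \<epsilon>)" by simp
    have "(\<integral>y. f2 (R y) \<partial>lborel) = (\<integral>y. f2 y \<partial>lborel)"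
      unfolding R_def using i2 by (intro lborel_integral_hyper_reflection[OF e]) simp
    moreover have "(\<integral>y. f \<epsilon> y \<partial>lborel) = (\<integral>y. f2 (R y) \<partial>lborel) - (\<integral>y. f1 y \<partial>lborel)"
      using \<open>integrable lborel f1\<close> \<open>integrable lborel (\<lambda>y. f2 (R y))\<close> by (simp add: f_eq)
    ultimately show "?J \<epsilon> = (\<integral>y. f \<epsilon> y \<partial>lborel)"
      by (simp add: set_lebesgue_integral_def frac_kernel_def f1_def f2_def N_def)
  qed
  have upper: "f \<epsilon> y + f \<epsilon> (R y) \<le> G \<epsilon> y + G \<epsilon> (R y)"
    if "0 < \<epsilon>" "\<epsilon> < d" and y: "l \<le> y \<bullet> e" for \<epsilon> y
  proof -
    \<comment> \<open>For \<open>\<epsilon> < d\<close> both balls lie strictly on the side of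
      \<open>x\<close>, so neither contains \<open>R y\<close>.\<close>
    have far: "v \<bullet> e \<ge> l + (d - \<epsilon>)" if "v \<in> ball x \<epsilon>" for v
      using that Cauchy_Schwarz_ineq2[of "x - v" e] e
      by (simp add: dist_norm d_def inner_diff_left)
    have "R y \<notin> ball x \<epsilon>" "R y \<notin> ball z r"
      using far[of "R y"] ball[of "R y"] y \<open>\<epsilon> < d\<close> by (auto simp: Re)
    then have GR: "G \<epsilon> (R y) = 0" and fR: "f \<epsilon> (R y) = (w x + w y) / N (x - R y)"
      by (simp_all add: G_def f_def wR)
    have dR: "d \<le> norm (x - R y)"
      using inner_le_norm_diff_hyper_reflection[OF e y, of x] by (simp add: d_def R_def)
    have powr_dR: "d powr (real DIM('a) + 2 * s) \<le> N (x - R y)"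
      unfolding N_def using dR \<open>0 < d\<close> s by (intro powr_mono2) auto
    have k2: "0 < N (x - R y)"
      using dR \<open>0 < d\<close> by (auto simp: N_def)
    show ?thesis
    proof (cases "y \<in> ball x \<epsilon>")
      case True
      have "w x + w y \<le> 4 * W"
        using bdd[of x] bdd[of "R x"] bdd[of y] bdd[of "R y"]
        unfolding w_def R_def[symmetric] by linarith
      then have "(w x + w y) / N (x - R y) \<le> 4 * W / N (x - R y)"
        using k2 by (intro divide_right_mono) auto
      also have "\<dots> \<le> 4 * W / d powr (real DIM('a) + 2 * s)"
        using powr_dR k2 \<open>0 \<le> W\<close> \<open>0 < d\<close> by (intro divide_left_mono mult_pos_pos) auto
      finally have "f \<epsilon> (R y) \<le> M - \<kappa>"
        by (simp add: fR M_def)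
      also have "M - \<kappa> \<le> G \<epsilon> y"
        using True \<kappa> by (simp add: G_def indicator_def)
      moreover have "f \<epsilon> y = 0"
        using True by (simp add: f_def)
      ultimately show ?thesis
        using GR by simp
    next
      case False
      then have "0 < norm (x - y)"
        using \<open>0 < \<epsilon>\<close> by auto
      have "N (x - y) \<le> N (x - R y)"
        unfolding N_def R_def using norm_diff_le_hyper_reflection[OF e _ y, of x] x s
        by (intro powr_mono2) auto
      moreover have "0 < N (x - y)"
        using \<open>0 < norm (x - y)\<close> by (auto simp: N_def)
      ultimately have "1 / N (x - R y) \<le> 1 / N (x - y)"
        by (simp add: frac_le)
      then have "(w x - w y) * (1 / N (x - y) - 1 / N (x - R y)) \<le> 0"
        using min[OF y] by (intro mult_nonpos_nonneg) auto
      moreover have "2 * w x / N (x - R y) \<le> 0"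
        using wx k2 by (simp add: divide_nonpos_pos)
      moreover have "f \<epsilon> y + f \<epsilon> (R y)
          = 2 * w x / N (x - R y) + (w x - w y) * (1 / N (x - y) - 1 / N (x - R y))"
        unfolding fR using False by (simp add: f_def diff_divide_distrib add_divide_distrib algebra_simps)
      moreover have "G \<epsilon> y = (if y \<in> ball z r then - \<kappa> else 0)"
        using False by (simp add: G_def)
      ultimately show ?thesis
        using key[of y, folded R_def] GR by (cases "y \<in> ball z r") simp_all
    qed
  qed
  have J_le: "?J \<epsilon> \<le> M * measure lborel (ball x \<epsilon>) - \<kappa> * measure lborel (ball z r)"
    if \<epsilon>: "0 < \<epsilon>" "\<epsilon> < d" for \<epsilon>
  proof -
    have G_int: "integrable lborel (G \<epsilon>)"
      using emeasure_lborel_ball_finite[of x \<epsilon>] emeasure_lborel_ball_finite[of z r]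
      unfolding G_def[abs_def] by (intro Bochner_Integration.integrable_diff integrable_mult_right) (auto simp: less_top)
    note R_int = lborel_integrable_hyper_reflection[OF e, of _ l, folded R_def]
    have R_eq: "(\<integral>y. g (R y) \<partial>lborel) = (\<integral>y. g y \<partial>lborel)" if "integrable lborel g" for g :: "'a \<Rightarrow> real"
      unfolding R_def using that by (intro lborel_integral_hyper_reflection[OF e]) simp
    \<comment> \<open>The symmetrised inequality is invariant under \<open>R\<close>, so the half
      space suffices; integrating it counts each integral twice.\<close>
    have "f \<epsilon> y + f \<epsilon> (R y) \<le> G \<epsilon> y + G \<epsilon> (R y)" for y
    proof (cases "l \<le> y \<bullet> e")
      case False
      then show ?thesis using upper[OF \<epsilon>, of "R y"] by (simp add: Re)
    qed (use upper \<epsilon> in blast)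
    then have "(\<integral>y. f \<epsilon> y + f \<epsilon> (R y) \<partial>lborel) \<le> (\<integral>y. G \<epsilon> y + G \<epsilon> (R y) \<partial>lborel)"
      using J(1)[OF \<epsilon>(1)] G_int R_int by (intro integral_mono) auto
    then have "(\<integral>y. f \<epsilon> y \<partial>lborel) \<le> (\<integral>y. G \<epsilon> y \<partial>lborel)"
      using J(1)[OF \<epsilon>(1)] G_int R_int R_eq by simp
    also have "(\<integral>y. G \<epsilon> y \<partial>lborel) = M * measure lborel (ball x \<epsilon>) - \<kappa> * measure lborel (ball z r)"
      using emeasure_lborel_ball_finite[of x \<epsilon>] emeasure_lborel_ball_finite[of z r]
      unfolding G_def by (subst Bochner_Integration.integral_diff) (auto simp: less_top)
    finally show ?thesis
      using J(2)[OF \<epsilon>(1)] by simp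
  qed
  have "(?J \<longlongrightarrow> I2 - I1) (at_right 0)"
    using I1 I2 by (intro tendsto_diff) (auto simp: has_frac_laplacian_def R_def)
  moreover have "((\<lambda>\<epsilon>. M * measure lborel (ball x \<epsilon>) - \<kappa> * measure lborel (ball z r))
      \<longlongrightarrow> M * 0 - \<kappa> * measure lborel (ball z r)) (at_right 0)"
  proof (intro tendsto_intros)
    have "((\<lambda>\<epsilon>. unit_ball_vol (real DIM('a)) * \<epsilon> ^ DIM('a)) \<longlongrightarrow> unit_ball_vol (real DIM('a)) * 0 ^ DIM('a)) (at_right 0)"
      by (intro tendsto_intros)
    moreover have "eventually (\<lambda>\<epsilon>. unit_ball_vol (real DIM('a)) * \<epsilon> ^ DIM('a) = measure lborel (ball x \<epsilon>)) (at_right 0)"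
      using eventually_at_right_less[of "0::real"]
      by eventually_elim (simp add: content_ball)
    ultimately show "((\<lambda>\<epsilon>. measure lborel (ball x \<epsilon>)) \<longlongrightarrow> 0) (at_right 0)"
      using Lim_transform_eventually by (fastforce simp: power_0_left)
  qed
  moreover have "eventually (\<lambda>\<epsilon>. ?J \<epsilon> \<le> M * measure lborel (ball x \<epsilon>) - \<kappa> * measure lborel (ball z r)) (at_right 0)"
    using eventually_at_right_real[OF \<open>0 < d\<close>] by eventually_elim (use J_le in auto)
  ultimately have "I2 - I1 \<le> M * 0 - \<kappa> * measure lborel (ball z r)"
    by (intro tendsto_le[OF trivial_limit_at_right_real]) auto
  then show ?thesis by simp
qed

text \<open>Mean value theorem, with the derivative increasing because \<open>p > 1\<close>. The
  slope is taken at the larger argument, which at a negative minimum is \<open>u x\<close>.\<close>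

lemma powr_tangent_le:
  fixes a b p :: real
  assumes "0 < b" "b < a" "1 < p"
  shows "a powr p - b powr p \<le> p * a powr (p - 1) * (a - b)"
proof -
  have "((\<lambda>t. t powr p) has_real_derivative p * t powr (p - 1)) (at t)" if "b \<le> t" for t
    using that \<open>0 < b\<close> by (intro has_real_derivative_powr) auto
  then obtain z where z: "b < z" "z < a" "a powr p - b powr p = (a - b) * (p * z powr (p - 1))"
    using MVT2[of b a "\<lambda>t. t powr p" "\<lambda>t. p * t powr (p - 1)"] \<open>b < a\<close> by blast
  have "z powr (p - 1) \<le> a powr (p - 1)"
    using z assms by (intro powr_mono2) auto
  then show ?thesis
    using z assms by (simp add: mult.commute mult_left_mono)
qed

section \<open>Moving planes\<close>

locale decaying_solution =
  fixes u :: "'a::euclidean_space \<Rightarrow> real" and c s p :: real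
  assumes s: "0 < s" and p: "1 < p" and c: "0 < c"
    and solution: "classical_positive_solution c s p u"
    and decay: "(u \<longlongrightarrow> 0) at_infinity"
begin

section \<open>Positivity, decay and the reflected difference\<close>

lemma pos: "0 < u x"
  using solution by (simp add: classical_positive_solution_def)

lemma C2: "C2 u"
  using solution by (simp add: classical_positive_solution_def)

lemma continuous: "continuous_on A u"
proof -
  have "continuous_on UNIV u"
    using C2 unfolding C2_def by (meson continuous_at_imp_continuous_on has_derivative_continuous)
  then show ?thesis
    using continuous_on_subset by blast
qed

lemma small_outside_ball:
  assumes "0 < \<epsilon>"
  obtains r where "0 < r" "\<And>x. r \<le> norm x \<Longrightarrow> u x < \<epsilon>"
proof -
  have "eventually (\<lambda>x. u x < \<epsilon>) at_infinity"
    using order_tendstoD(2)[OF decay assms] .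
  then show ?thesis
    using that by (auto simp: eventually_at_infinity_pos)
qed

lemma bounded_above:
  obtains W where "\<And>x. \<bar>u x\<bar> \<le> W"
proof -
  obtain r where r: "0 < r" "\<And>x. r \<le> norm x \<Longrightarrow> u x < 1"
    using small_outside_ball[of 1] by auto
  obtain z where z: "\<And>x. x \<in> cball 0 r \<Longrightarrow> u x \<le> u z"
    using continuous_attains_sup[OF compact_cball _ continuous, of 0 r] r(1) by fastforce
  have "\<bar>u x\<bar> \<le> max 1 (u z)" for x
    using r(2)[of x] z[of x] pos[of x] by (cases "r \<le> norm x") auto
  then show ?thesis
    using that by blast
qed

definition reflection_gap :: "'a \<Rightarrow> real \<Rightarrow> 'a \<Rightarrow> real" where
  "reflection_gap e l y = u (hyper_reflection e l y) - u y"

text \<open>The strict \<open>l < x \<bullet> e\<close> makes \<open>x\<close> an interior minimum,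
  to which the estimates for both operators apply.\<close>

definition negative_min :: "'a \<Rightarrow> real \<Rightarrow> 'a \<Rightarrow> bool" where
  "negative_min e l x \<longleftrightarrow> l < x \<bullet> e \<and> reflection_gap e l x < 0 \<and>
     (\<forall>y. l \<le> y \<bullet> e \<longrightarrow> reflection_gap e l x \<le> reflection_gap e l y)"

text \<open>Plane and point vary together, as needed when the minima for a sequence of planes
  converge.\<close>

lemma tendsto_reflection_gap:
  assumes "(f \<longlongrightarrow> l) F" "(g \<longlongrightarrow> x) F"
  shows "((\<lambda>k. reflection_gap e (f k) (g k)) \<longlongrightarrow> reflection_gap e l x) F"
proof -
  have "isCont u y" for y
    using continuous[of UNIV] continuous_on_eq_continuous_at open_UNIV by blast
  then show ?thesis
    unfolding reflection_gap_def hyper_reflection_def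
    by (intro tendsto_diff isCont_tendsto_compose[OF \<open>\<And>y. isCont u y\<close>] tendsto_intros assms)
qed

lemma continuous_on_reflection_gap: "continuous_on A (reflection_gap e l)"
  unfolding continuous_on_def by (auto intro!: tendsto_reflection_gap)

lemma reflection_gap_boundary: "y \<bullet> e = l \<Longrightarrow> reflection_gap e l y = 0"
  by (simp add: reflection_gap_def hyper_reflection_def)

section \<open>The equation at minima of the gap\<close>

text \<open>Subtract the equations at \<open>x\<close> and at its mirror image; the difference of
  the Laplacians drops out by its sign. The sign of the gap is left open, so that this serves both
  negative minima and touching points.\<close>

lemma gap_equation_at_min:
  assumes e: "norm e = 1" and x: "l < x \<bullet> e"
    and min: "\<And>y. l \<le> y \<bullet> e \<Longrightarrow> reflection_gap e l x \<le> reflection_gap e l y"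
  obtains I1 I2 where "has_frac_laplacian 1 s u I1 x"
    "has_frac_laplacian 1 s u I2 (hyper_reflection e l x)"
    "u (hyper_reflection e l x) powr p - u x powr p \<le> c * (I2 - I1) + reflection_gap e l x"
proof -
  have equation: "\<exists>I. has_frac_laplacian 1 s u I y \<and> - laplacian u y + c * I + u y = u y powr p" for y
    using solution unfolding classical_positive_solution_def has_frac_laplacian_def by force
  obtain I1 where I1: "has_frac_laplacian 1 s u I1 x"
    "- laplacian u x + c * I1 + u x = u x powr p"
    using equation by blast
  let ?x = "hyper_reflection e l x"
  obtain I2 where I2: "has_frac_laplacian 1 s u I2 ?x"
    "- laplacian u ?x + c * I2 + u ?x = u ?x powr p"
    using equation by blast
  have "laplacian u x \<le> laplacian u ?x"
  proof (rule laplacian_reflection_ge_at_local_min[OF e C2])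
    show "0 < x \<bullet> e - l" using x by simp
    show "u ?x - u x \<le> u (hyper_reflection e l y) - u y" if "y \<in> ball x (x \<bullet> e - l)" for y
      using that Cauchy_Schwarz_ineq2[of "x - y" e] e min[of y]
      by (simp add: dist_norm inner_diff_left reflection_gap_def)
  qed
  then show ?thesis
    using that[OF I1(1) I2(1)] I1(2) I2(2) by (simp add: reflection_gap_def algebra_simps)
qed

text \<open>The constant left after multiplying \<open>c\<close>, the kernel bound
  \<open>2 / (3 * d) powr (n + 2 * s)\<close> and the volume of a ball of radius \<open>d\<close> in
  dimension \<open>n\<close>; the powers of \<open>d\<close> combine to
  \<open>d powr (- 2 * s)\<close>.\<close>

definition gap_const :: real where
  "gap_const = 2 * c * unit_ball_vol DIM('a) / 3 powr (real DIM('a) + 2 * s)"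

lemma gap_const_pos: "0 < gap_const"
  using c by (simp add: gap_const_def)

text \<open>
  Only the mirror image of \<open>ball x d\<close>, at distance at most \<open>3 d\<close> from \<open>x\<close>, is used from the nonlocal
  term.  Its blow-up as \<open>d \<rightarrow> 0\<close> plays the role of the Hopf lemma.
\<close>

lemma negative_min_estimate:
  assumes e: "norm e = 1" and "negative_min e l x"
  shows "1 + gap_const * (x \<bullet> e - l) powr (- 2 * s) \<le> p * u x powr (p - 1)"
proof -
  define w where "w = reflection_gap e l"
  have x: "l < x \<bullet> e" and wx: "w x < 0" and min: "\<And>y. l \<le> y \<bullet> e \<Longrightarrow> w x \<le> w y"
    using assms(2) by (auto simp: negative_min_def w_def)
  define d where "d = x \<bullet> e - l"
  have "0 < d" using x by (simp add: d_def)
  define q where "q = real DIM('a) + 2 * s"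
  have "0 < q" using s by (simp add: q_def add_nonneg_pos)
  define R where "R = hyper_reflection e l"
  obtain I1 I2 where I: "has_frac_laplacian 1 s u I1 x" "has_frac_laplacian 1 s u I2 (R x)"
    "u (R x) powr p - u x powr p \<le> c * (I2 - I1) + w x"
    unfolding R_def w_def by (rule gap_equation_at_min[OF e x]) (use min w_def in auto)
  obtain W where W: "\<And>x. \<bar>u x\<bar> \<le> W"
    using bounded_above by blast
  define \<kappa> where "\<kappa> = - 2 * w x / (3 * d) powr q"
  have ball: "l < y \<bullet> e" "y \<bullet> e - l < 2 * d" if "y \<in> ball x d" for y
    using that Cauchy_Schwarz_ineq2[of "x - y" e] e
    by (auto simp: dist_norm d_def inner_diff_left)
  have "I2 - I1 \<le> - \<kappa> * measure lborel (ball x d)"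
  proof (rule frac_laplacian_reflection_le[OF e s _ W I(1) I(2)[unfolded R_def] x])
    show "u \<in> borel_measurable borel"
      using continuous borel_measurable_continuous_onI by blast
    fix y assume y: "y \<in> ball x d"
    \<comment> \<open>The squared distance to the mirror point is at most
      \<open>d\<^sup>2 + 4 * d * (2 * d)\<close>, which explains the radius
      \<open>3 * d\<close>.\<close>
    have "(norm (x - y))\<^sup>2 \<le> d\<^sup>2"
      using y by (intro power_mono) (auto simp: dist_norm)
    moreover have "d * (y \<bullet> e - l) \<le> d * (2 * d)"
      using ball(2)[OF y] \<open>0 < d\<close> by (intro mult_left_mono) auto
    moreover have "(norm (x - R y))\<^sup>2 = (norm (x - y))\<^sup>2 + 4 * (d * (y \<bullet> e - l))"
      unfolding R_def norm_diff_hyper_reflection[OF e] by (simp add: d_def)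
    ultimately have "(norm (x - R y))\<^sup>2 \<le> (3 * d)\<^sup>2"
      by (simp add: power2_eq_square)
    then have "norm (x - R y) \<le> 3 * d"
      by (rule power2_le_imp_le) (use \<open>0 < d\<close> in simp)
    then have le: "norm (x - R y) powr q \<le> (3 * d) powr q"
      using \<open>0 < q\<close> by (intro powr_mono2) auto
    have mono: "norm (x - y) < norm (x - R y)"
      unfolding R_def by (rule norm_diff_less_hyper_reflection[OF e x ball(1)[OF y]])
    then have "0 < norm (x - R y)"
      by (meson norm_ge_zero order_le_less_trans)
    then have "2 * w x / norm (x - R y) powr q \<le> 2 * w x / (3 * d) powr q"
      using le wx \<open>0 < d\<close> by (intro divide_left_mono_neg mult_pos_pos) auto
    then have "2 * w x / norm (x - R y) powr q \<le> - \<kappa>"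
      by (simp add: \<kappa>_def)
    moreover have "(w x - w y) * (1 / norm (x - y) powr q - 1 / norm (x - R y) powr q) \<le> 0"
    \<comment> \<open>At \<open>y = x\<close> the first kernel has the default value
      \<open>1 / 0 = 0\<close>, but the factor \<open>w x - w y\<close> vanishes anyway.\<close>
    proof (cases "y = x")
      case False
      then have "1 / norm (x - R y) powr q \<le> 1 / norm (x - y) powr q"
        using mono \<open>0 < q\<close> by (intro divide_left_mono powr_mono2 mult_pos_pos) auto
      then show ?thesis
        using min[of y] ball(1)[OF y] by (intro mult_nonpos_nonneg) auto
    qed simp
    ultimately show "2 * (u (hyper_reflection e l x) - u x) /
        norm (x - hyper_reflection e l y) powr (real DIM('a) + 2 * s) +
      (u (hyper_reflection e l x) - u x - (u (hyper_reflection e l y) - u y)) *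
        (1 / norm (x - y) powr (real DIM('a) + 2 * s) -
         1 / norm (x - hyper_reflection e l y) powr (real DIM('a) + 2 * s)) \<le> - \<kappa>"
      by (simp add: w_def reflection_gap_def R_def q_def)
  qed (use wx min ball \<open>0 < d\<close> in \<open>auto simp: w_def reflection_gap_def \<kappa>_def divide_nonpos_nonneg\<close>)
  moreover have "c * (\<kappa> * measure lborel (ball x d)) = - w x * (gap_const * d powr (- 2 * s))"
  proof -
    have "d powr q = d ^ DIM('a) * d powr (2 * s)"
      using \<open>0 < d\<close> by (simp add: q_def powr_add powr_realpow)
    moreover have "gap_const = 2 * c * unit_ball_vol DIM('a) / 3 powr q"
      by (simp add: gap_const_def q_def)
    ultimately show ?thesis
      using \<open>0 < d\<close> by (simp add: \<kappa>_def powr_mult powr_minus content_ball field_simps)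
  qed
  ultimately have "c * (I2 - I1) \<le> w x * (gap_const * d powr (- 2 * s))"
    using c mult_left_mono[of "I2 - I1" "- \<kappa> * measure lborel (ball x d)" c] by simp
  moreover have "u x powr p - u (R x) powr p \<le> p * u x powr (p - 1) * (u x - u (R x))"
    by (rule powr_tangent_le[OF pos _ p]) (use wx in \<open>simp add: w_def R_def reflection_gap_def\<close>)
  \<comment> \<open>Every term now carries the factor \<open>w x\<close>; cancelling it reverses the
    inequality, since \<open>w x < 0\<close>.\<close>
  ultimately have "w x * (p * u x powr (p - 1)) \<le> w x * (1 + gap_const * d powr (- 2 * s))"
    using I(3) by (simp add: w_def R_def reflection_gap_def algebra_simps)
  then show ?thesis
    using wx by (simp add: d_def)
qed

text \<open>The two summands on the left of \<open>negative_min_estimate\<close> act separately: the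
  1 prevents \<open>u x\<close> from being small, and the singular term prevents the distance to the
  plane from being small. The bounds depend on neither \<open>e\<close> nor
  \<open>l\<close>.\<close>

lemma negative_min_confined:
  obtains \<rho> \<delta> where "0 < \<delta>"
    "\<And>e l x. norm e = 1 \<Longrightarrow> negative_min e l x \<Longrightarrow> norm x \<le> \<rho> \<and> \<delta> \<le> x \<bullet> e - l"
proof -
  obtain W where W: "\<And>x. \<bar>u x\<bar> \<le> W"
    using bounded_above by blast
  have "0 < W" using W[of 0] pos[of 0] by simp
  \<comment> \<open>The value at which \<open>p * \<epsilon> powr (p - 1) = 1\<close>.\<close>
  define \<epsilon> where "\<epsilon> = (1 / p) powr (1 / (p - 1))"
  have "0 < \<epsilon>" using p by (simp add: \<epsilon>_def)
  then obtain \<rho> where \<rho>: "\<And>x. \<rho> \<le> norm x \<Longrightarrow> u x < \<epsilon>"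
    using small_outside_ball by blast
  define A where "A = p * W powr (p - 1) / gap_const"
  have "0 < A" using p \<open>0 < W\<close> gap_const_pos by (simp add: A_def)
  \<comment> \<open>Solves
    \<open>gap_const * \<delta> powr (- 2 * s) = p * W powr (p - 1)\<close>.\<close>
  define \<delta> where "\<delta> = A powr (- 1 / (2 * s))"
  have "0 < \<delta>" using \<open>0 < A\<close> by (simp add: \<delta>_def)
  show ?thesis
  proof (rule that[OF \<open>0 < \<delta>\<close>], intro conjI)
    fix e l x assume e: "norm e = 1" and nm: "negative_min e l x"
    define d where "d = x \<bullet> e - l"
    have "0 < d" using nm by (simp add: d_def negative_min_def)
    note est = negative_min_estimate[OF e nm, folded d_def]
    show "norm x \<le> \<rho>"
    proof (rule ccontr)
      assume "\<not> norm x \<le> \<rho>"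
      then have "u x powr (p - 1) < \<epsilon> powr (p - 1)"
        using \<rho> pos[of x] p by (intro powr_less_mono2) auto
      also have "\<epsilon> powr (p - 1) = 1 / p"
        using p by (simp add: \<epsilon>_def powr_powr)
      finally have "p * u x powr (p - 1) < 1"
        using p by (simp add: field_simps)
      moreover have "0 \<le> gap_const * d powr (- 2 * s)"
        using gap_const_pos by simp
      ultimately show False using est by linarith
    qed
    show "\<delta> \<le> x \<bullet> e - l"
    proof (rule ccontr)
      assume "\<not> \<delta> \<le> x \<bullet> e - l"
      then have "\<delta> powr (- 2 * s) < d powr (- 2 * s)"
        using s \<open>0 < d\<close> by (intro powr_less_mono2_neg) (auto simp: d_def)
      also have "\<delta> powr (- 2 * s) = A"
        using s \<open>0 < A\<close> by (simp add: \<delta>_def powr_powr)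
      finally have "p * W powr (p - 1) < gap_const * d powr (- 2 * s)"
        using gap_const_pos by (simp add: A_def field_simps)
      moreover have "p * u x powr (p - 1) \<le> p * W powr (p - 1)"
        using W[of x] pos[of x] p by (intro mult_left_mono powr_mono2) auto
      ultimately show False using est by linarith
    qed
  qed
qed

section \<open>The critical position of the plane\<close>

text \<open>By positivity the gap at \<open>y\<close> exceeds \<open>- u y\<close>, which far out is
  above the value at \<open>z\<close>. So minimising over a large ball containing \<open>z\<close>
  minimises over the whole half space.\<close>

lemma negative_min_exists:
  assumes e: "norm e = 1" and z: "l \<le> z \<bullet> e" "reflection_gap e l z < 0"
  obtains x where "negative_min e l x"
proof -
  obtain r where r: "\<And>x. r \<le> norm x \<Longrightarrow> u x < - reflection_gap e l z"
    using small_outside_ball[of "- reflection_gap e l z"] z by auto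
  define K where "K = cball 0 (max r (norm z)) \<inter> {y. l \<le> y \<bullet> e}"
  have "compact K"
    unfolding K_def using closed_halfspace_ge[of l e]
    by (intro compact_Int_closed) (auto simp: inner_commute)
  moreover have "z \<in> K" using z by (simp add: K_def)
  ultimately obtain x where x: "x \<in> K" "\<And>y. y \<in> K \<Longrightarrow> reflection_gap e l x \<le> reflection_gap e l y"
    using continuous_attains_inf[OF _ _ continuous_on_reflection_gap, of K] by fastforce
  have xz: "reflection_gap e l x \<le> reflection_gap e l z"
    by (rule x(2)) fact
  have "reflection_gap e l x \<le> reflection_gap e l y" if "l \<le> y \<bullet> e" for y
  proof (cases "y \<in> K")
    case False
    then have "r \<le> norm y" using that by (auto simp: K_def)
    then show ?thesis
      using r[of y] xz pos[of "hyper_reflection e l y"] by (simp add: reflection_gap_def)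
  qed (use x in auto)
  moreover have "reflection_gap e l x < 0"
    using xz z by linarith
  moreover from this have "x \<bullet> e \<noteq> l"
    using reflection_gap_boundary[of x e l] by auto
  ultimately have "negative_min e l x"
    using x(1) by (auto simp: negative_min_def K_def)
  then show ?thesis using that by blast
qed

text \<open>A strong maximum principle: at the zero \<open>x\<close> the equation requires
  \<open>0 \<le> c * (I2 - I1)\<close>, but a positive gap at any \<open>z\<close> in the half
  space, however far away, makes \<open>I2 - I1\<close> negative.\<close>

lemma reflection_symmetric_if_touching:
  assumes e: "norm e = 1" and nonneg: "\<And>y. l \<le> y \<bullet> e \<Longrightarrow> 0 \<le> reflection_gap e l y"
    and x: "l < x \<bullet> e" "reflection_gap e l x = 0"
  shows "u (hyper_reflection e l y) = u y"
proof -
  define w where "w = reflection_gap e l"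
  define R where "R = hyper_reflection e l"
  have "w z = 0" if "l \<le> z \<bullet> e" for z
  proof (rule ccontr)
    assume "w z \<noteq> 0"
    then have "0 < w z" and z: "l < z \<bullet> e"
      using nonneg[OF that] reflection_gap_boundary[of z e l] that
      by (auto simp: w_def order_less_le)
    then have "z \<noteq> x"
      using x by (auto simp: w_def)
    define q where "q = real DIM('a) + 2 * s"
    have "0 < q" using s by (simp add: q_def add_nonneg_pos)
    obtain I1 I2 where I: "has_frac_laplacian 1 s u I1 x" "has_frac_laplacian 1 s u I2 (R x)"
      "u (R x) powr p - u x powr p \<le> c * (I2 - I1) + w x"
      unfolding R_def w_def by (rule gap_equation_at_min[OF e x(1)]) (use nonneg x in auto)
    obtain W where W: "\<And>x. \<bar>u x\<bar> \<le> W"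
      using bounded_above by blast
    \<comment> \<open>With \<open>w x = 0\<close> the integrand bounded in
      \<open>frac_laplacian_reflection_le\<close> is \<open>- h y\<close>; continuity gives
      \<open>h > h z / 2\<close> on a ball around \<open>z\<close>.\<close>
    define h where "h y = w y * (1 / norm (x - y) powr q - 1 / norm (x - R y) powr q)" for y
    have less: "norm (x - z) < norm (x - R z)"
      unfolding R_def by (rule norm_diff_less_hyper_reflection[OF e x(1) z])
    have "norm (x - z) powr q < norm (x - R z) powr q"
      using less \<open>0 < q\<close> by (intro powr_less_mono2) auto
    then have "1 / norm (x - R z) powr q < 1 / norm (x - z) powr q"
      using \<open>z \<noteq> x\<close> by (intro divide_strict_left_mono mult_pos_pos) auto
    then have "0 < h z"
      using \<open>0 < w z\<close> by (simp add: h_def)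
    have "isCont w z"
      using continuous_on_reflection_gap[of UNIV e l] continuous_on_eq_continuous_at[of UNIV w]
      by (simp add: w_def)
    moreover have "isCont R z"
      using continuous_on_hyper_reflection[OF e continuous_on_id, of UNIV l]
        continuous_on_eq_continuous_at[of UNIV R]
      by (simp add: R_def)
    ultimately have "isCont h z"
      using \<open>z \<noteq> x\<close> less unfolding h_def by (intro continuous_intros) auto
    then have "eventually (\<lambda>y. h z / 2 < h y) (nhds z)"
      using \<open>0 < h z\<close> order_tendstoD(1)[of h "h z" "nhds z" "h z / 2"]
      by (simp add: continuous_at tendsto_nhds_iff)
    moreover have "eventually (\<lambda>y. l < y \<bullet> e) (nhds z)"
    proof (rule order_tendstoD(1)[OF _ z])
      show "((\<lambda>y. y \<bullet> e) \<longlongrightarrow> z \<bullet> e) (nhds z)"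
        by (intro tendsto_intros filterlim_ident)
    qed
    ultimately have "eventually (\<lambda>y. h z / 2 < h y \<and> l < y \<bullet> e) (nhds z)"
      by (rule eventually_conj)
    then obtain r where r: "0 < r" "\<And>y. y \<in> ball z r \<Longrightarrow> h z / 2 < h y \<and> l < y \<bullet> e"
      unfolding eventually_nhds_metric by (auto simp: dist_commute)
    have "I2 - I1 \<le> - (h z / 2) * measure lborel (ball z r)"
    proof (rule frac_laplacian_reflection_le[OF e s _ W I(1) I(2)[unfolded R_def] x(1)])
      show "u \<in> borel_measurable borel"
        using continuous borel_measurable_continuous_onI by blast
      fix y assume y: "y \<in> ball z r"
      have "2 * w x / norm (x - R y) powr q
          + (w x - w y) * (1 / norm (x - y) powr q - 1 / norm (x - R y) powr q) = - h y"
        using x(2) by (simp add: w_def[symmetric] h_def)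
      also have "\<dots> \<le> - (h z / 2)"
        using r(2)[OF y] by simp
      finally show "2 * (u (hyper_reflection e l x) - u x) /
          norm (x - hyper_reflection e l y) powr (real DIM('a) + 2 * s) +
        (u (hyper_reflection e l x) - u x - (u (hyper_reflection e l y) - u y)) *
          (1 / norm (x - y) powr (real DIM('a) + 2 * s) -
           1 / norm (x - hyper_reflection e l y) powr (real DIM('a) + 2 * s)) \<le> - (h z / 2)"
        by (simp only: w_def reflection_gap_def R_def q_def)
    qed (use x nonneg r(2) \<open>0 < h z\<close> in \<open>auto simp: reflection_gap_def\<close>)
    also have "\<dots> < 0"
      using \<open>0 < h z\<close> content_ball_pos[OF r(1), of z] by simp
    finally have "c * (I2 - I1) < 0"
      using c by (simp add: mult_pos_neg)
    then show False
      using I(3) x(2) by (simp add: w_def R_def reflection_gap_def)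
  qed
  \<comment> \<open>Antisymmetry extends the vanishing to the other side of the plane.\<close>
  then have "w (if l \<le> y \<bullet> e then y else R y) = 0"
    by (auto simp: R_def hyper_reflection_inner[OF e])
  then show ?thesis
    by (auto simp: w_def R_def reflection_gap_def hyper_reflection_involution[OF e] split: if_splits)
qed

lemma symmetry_plane_exists:
  assumes e: "norm e = 1"
  obtains l where "\<And>y. u (hyper_reflection e l y) = u y"
proof -
  obtain \<rho> \<delta> where "0 < \<delta>"
    and confined: "\<And>l x. negative_min e l x \<Longrightarrow> norm x \<le> \<rho> \<and> \<delta> \<le> x \<bullet> e - l"
    using negative_min_confined e by metis
  define S where "S l \<longleftrightarrow> (\<forall>y. l \<le> y \<bullet> e \<longrightarrow> 0 \<le> reflection_gap e l y)" for l
  have not_S: "\<exists>x. negative_min e l x" if "\<not> S l" for l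
    using that negative_min_exists[OF e] unfolding S_def by (metis not_le)
  define A where "A = {l. \<forall>m\<ge>l. S m}"
  \<comment> \<open>For a plane at \<open>m \<ge> \<rho>\<close>, a point of norm at most
    \<open>\<rho>\<close> cannot lie at distance \<open>\<delta>\<close> beyond the plane.\<close>
  have "\<rho> \<in> A"
    unfolding A_def
  proof (intro CollectI allI impI, rule ccontr)
    fix m assume "\<rho> \<le> m" "\<not> S m"
    then obtain x where x: "negative_min e m x" using not_S by blast
    have "x \<bullet> e \<le> norm x"
      using norm_cauchy_schwarz[of x e] e by simp
    then show False
      using confined[OF x] \<open>0 < \<delta>\<close> \<open>\<rho> \<le> m\<close> by linarith
  qed
  obtain r where r: "0 < r" "\<And>x. r \<le> norm x \<Longrightarrow> u x < u 0"
    using small_outside_ball pos by blast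
  \<comment> \<open>For \<open>l < - r\<close> the origin lies in the half space and is mirrored to
    norm at least \<open>r\<close>, where \<open>u\<close> is below \<open>u 0\<close>; its gap is
    therefore negative.\<close>
  have "bdd_below A"
  proof (rule bdd_belowI)
    fix l assume "l \<in> A"
    show "- r \<le> l"
    proof (rule ccontr)
      assume "\<not> - r \<le> l"
      then have "reflection_gap e l 0 < 0"
        using r e by (simp add: reflection_gap_def hyper_reflection_def)
      moreover have "S l"
        using \<open>l \<in> A\<close> by (simp add: A_def)
      ultimately show False
        using \<open>\<not> - r \<le> l\<close> r(1) by (auto simp: S_def not_le dest!: spec[of _ 0])
    qed
  qed
  define l0 where "l0 = Inf A"
  have above: "S m" if m: "l0 < m" for m
  proof -
    obtain l where "l \<in> A" "l < m"
      using cInf_lessD[of A m] m \<open>\<rho> \<in> A\<close> unfolding l0_def by blast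
    then show ?thesis by (auto simp: A_def)
  qed
  \<comment> \<open>Just left of the infimum some position fails, and it cannot exceed
    \<open>l0\<close>, because all positions above \<open>l0\<close> succeed.\<close>
  have "\<exists>m x. l0 - 1 / real (Suc k) \<le> m \<and> m \<le> l0 \<and> negative_min e m x" for k
  proof -
    have "l0 - 1 / real (Suc k) \<notin> A"
    proof
      assume "l0 - 1 / real (Suc k) \<in> A"
      then have "l0 \<le> l0 - 1 / real (Suc k)"
        unfolding l0_def using \<open>bdd_below A\<close> by (rule cInf_lower)
      then show False by simp
    qed
    then obtain m where m: "l0 - 1 / real (Suc k) \<le> m" "\<not> S m"
      by (auto simp: A_def)
    then show ?thesis
      using not_S above by (meson not_le)
  qed
  then obtain m x where mx: "\<And>k. l0 - 1 / real (Suc k) \<le> m k" "\<And>k. m k \<le> l0"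
    "\<And>k. negative_min e (m k) (x k)"
    by metis
  have "m \<longlonglongrightarrow> l0"
  proof (rule tendsto_sandwich[OF _ _ _ tendsto_const])
    show "(\<lambda>k. l0 - 1 / real (Suc k)) \<longlonglongrightarrow> l0"
      using tendsto_diff[OF tendsto_const LIMSEQ_inverse_real_of_nat, of l0]
      by (simp add: inverse_eq_divide)
  qed (use mx in auto)
  obtain x0 \<phi> where \<phi>: "strict_mono \<phi>" "(x \<circ> \<phi>) \<longlonglongrightarrow> x0"
  proof -
    have "\<forall>k. x k \<in> cball 0 \<rho>"
      using confined[OF mx(3)] by simp
    then show ?thesis
      using that compact_cball[of "0::'a" \<rho>] unfolding compact_def by blast
  qed
  have m\<phi>: "(m \<circ> \<phi>) \<longlonglongrightarrow> l0"
    using \<open>m \<longlonglongrightarrow> l0\<close> \<phi>(1) by (rule LIMSEQ_subseq_LIMSEQ)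
  have "(\<lambda>k. reflection_gap e ((m \<circ> \<phi>) k) ((x \<circ> \<phi>) k)) \<longlonglongrightarrow> reflection_gap e l0 x0"
    by (rule tendsto_reflection_gap[OF m\<phi> \<phi>(2)])
  \<comment> \<open>Negative gaps pass to the limit only as a nonpositive one, but the uniform
    \<open>\<delta>\<close> keeps the limit point off the plane.\<close>
  then have gap_le: "reflection_gap e l0 x0 \<le> 0"
    by (rule LIMSEQ_le_const2) (use mx(3) in \<open>auto simp: negative_min_def less_imp_le\<close>)
  have "(\<lambda>k. (x \<circ> \<phi>) k \<bullet> e - (m \<circ> \<phi>) k) \<longlonglongrightarrow> x0 \<bullet> e - l0"
    by (intro tendsto_intros \<phi> m\<phi>)
  then have "\<delta> \<le> x0 \<bullet> e - l0"
    by (rule LIMSEQ_le_const) (use confined[OF mx(3)] in auto)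
  \<comment> \<open>A point strictly beyond the plane at \<open>l0\<close> stays beyond slightly
    larger positions, where \<open>S\<close> holds; let these decrease to \<open>l0\<close>.\<close>
  have "S l0"
  proof (rule ccontr)
    assume "\<not> S l0"
    then obtain z where z: "l0 < z \<bullet> e" "reflection_gap e l0 z < 0"
      using not_S unfolding negative_min_def by blast
    have "((\<lambda>l. reflection_gap e l z) \<longlongrightarrow> reflection_gap e l0 z) (at_right l0)"
      by (intro tendsto_reflection_gap tendsto_intros)
    moreover have "eventually (\<lambda>l. 0 \<le> reflection_gap e l z) (at_right l0)"
      using eventually_at_right_real[OF z(1)] by eventually_elim (use above in \<open>auto simp: S_def\<close>)
    ultimately have "0 \<le> reflection_gap e l0 z"
      by (rule tendsto_lowerbound) simp
    then show False using z by simp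
  qed
  have "u (hyper_reflection e l0 y) = u y" for y
  proof (rule reflection_symmetric_if_touching[OF e])
    show "l0 < x0 \<bullet> e"
      using \<open>\<delta> \<le> x0 \<bullet> e - l0\<close> \<open>0 < \<delta>\<close> by simp
    then show "reflection_gap e l0 x0 = 0"
      using \<open>S l0\<close> gap_le by (simp add: S_def order_antisym)
  qed (use \<open>S l0\<close> in \<open>auto simp: S_def\<close>)
  then show ?thesis using that by blast
qed

section \<open>From symmetry planes to radial symmetry\<close>

text \<open>The multiples of a nonzero \<open>v\<close> would carry the positive value
  \<open>u 0\<close> to infinity, against the decay.\<close>

lemma no_translation_symmetry:
  assumes "\<And>x. u (x + v) = u x"
  shows "v = 0"
proof (rule ccontr)
  assume "v \<noteq> 0"
  have shifts: "u (real k *\<^sub>R v) = u 0" for k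
  proof (induction k)
    case (Suc k)
    then show ?case
      using assms[of "real k *\<^sub>R v"] by (simp add: scaleR_add_left add.commute)
  qed simp
  obtain r where r: "\<And>x. r \<le> norm x \<Longrightarrow> u x < u 0"
    using small_outside_ball pos by blast
  obtain k :: nat where "r / norm v \<le> real k"
    using real_arch_simple by blast
  then have "r \<le> norm (real k *\<^sub>R v)"
    using \<open>v \<noteq> 0\<close> by (simp add: divide_le_eq)
  then show False
    using r shifts[of k] by fastforce
qed

text \<open>
  Composing the reflections along the coordinate axes gives a point symmetry about \<open>x0\<close>.  A symmetry
  plane missing \<open>x0\<close> would, together with its image under the point symmetry, yield a translation
  symmetry, so every symmetry plane passes through \<open>x0\<close>.
\<close>

lemma radially_symmetric: "\<exists>x0. radially_symmetric_about x0 u"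
proof -
  define plane where "plane e = (SOME l. \<forall>y. u (hyper_reflection e l y) = u y)" for e
  have plane: "u (hyper_reflection e (plane e) y) = u y" if e: "norm e = 1" for e y
  proof -
    have "\<exists>l. \<forall>y. u (hyper_reflection e l y) = u y"
      using symmetry_plane_exists[OF e] by metis
    from someI_ex[OF this] show ?thesis
      unfolding plane_def by blast
  qed
  define x0 where "x0 = (\<Sum>b\<in>Basis. plane b *\<^sub>R b)"
  \<comment> \<open>Coordinate reflections act on separate coordinates, so they can be composed one
    axis at a time.\<close>
  have partial: "u (y + (\<Sum>b\<in>B. (2 * (plane b - y \<bullet> b)) *\<^sub>R b)) = u y"
    if "finite B" "B \<subseteq> Basis" for B y
    using that
  proof (induction B)
    case (insert b B)
    let ?z = "y + (\<Sum>b\<in>B. (2 * (plane b - y \<bullet> b)) *\<^sub>R b)"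
    have "(\<Sum>i\<in>B. (2 * (plane i - y \<bullet> i)) *\<^sub>R i) \<bullet> b = 0"
      using insert.hyps insert.prems unfolding inner_sum_left
      by (intro sum.neutral ballI) (metis inner_not_same_Basis inner_scaleR_left insert_subset mult_zero_right subsetD)
    then have "hyper_reflection b (plane b) ?z
        = y + (\<Sum>i\<in>insert b B. (2 * (plane i - y \<bullet> i)) *\<^sub>R i)"
      using insert.hyps by (simp add: hyper_reflection_def inner_add_left)
    then show ?case
      using plane[of b ?z] insert by simp
  qed simp
  have point_symmetric: "u (2 *\<^sub>R x0 - y) = u y" for y
  proof -
    have "y + (\<Sum>b\<in>Basis. (2 * (plane b - y \<bullet> b)) *\<^sub>R b)
        = y + (2 *\<^sub>R x0 - 2 *\<^sub>R (\<Sum>b\<in>Basis. (y \<bullet> b) *\<^sub>R b))"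
      unfolding x0_def scaleR_sum_right sum_subtractf[symmetric]
      by (simp add: algebra_simps)
    also have "\<dots> = 2 *\<^sub>R x0 - y"
      unfolding euclidean_representation by (simp add: scaleR_2)
    finally show ?thesis
      using partial[of Basis y] by simp
  qed
  have through: "plane e = x0 \<bullet> e" if e: "norm e = 1" for e
  proof -
    \<comment> \<open>Point symmetry, reflection, point symmetry, reflection: the composition is
      this translation.\<close>
    have "u (y + (4 * (plane e - x0 \<bullet> e)) *\<^sub>R e) = u y" for y
    proof -
      define y' where "y' = hyper_reflection e (plane e) (2 *\<^sub>R x0 - y)"
      have "y + (4 * (plane e - x0 \<bullet> e)) *\<^sub>R e = hyper_reflection e (plane e) (2 *\<^sub>R x0 - y')"
        using inner_unit_self[OF e]
        by (simp add: y'_def hyper_reflection_def algebra_simps scaleR_2)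
           (simp flip: scaleR_left_distrib)
      then show ?thesis
        using plane[OF e] point_symmetric by (simp add: y'_def)
    qed
    then have "(4 * (plane e - x0 \<bullet> e)) *\<^sub>R e = 0"
      by (rule no_translation_symmetry)
    then show ?thesis using e by auto
  qed
  have rotation: "u y = u z" if eq: "norm (y - x0) = norm (z - x0)" for y z
  proof (cases "y = z")
    case False
    \<comment> \<open>The unit normal of the perpendicular bisector of \<open>y\<close> and
      \<open>z\<close>, which contains \<open>x0\<close> because both points are equally far from
      it.\<close>
    define e where "e = (z - y) /\<^sub>R norm (z - y)"
    have e: "norm e = 1" using False by (simp add: e_def)
    have "(norm (z - x0))\<^sup>2 = (norm (z - y))\<^sup>2 + 2 * ((z - y) \<bullet> (y - x0)) + (norm (y - x0))\<^sup>2"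
      by (simp add: power2_norm_eq_inner algebra_simps inner_commute)
    then have "2 * (x0 \<bullet> (z - y) - y \<bullet> (z - y)) = (norm (z - y))\<^sup>2"
      using eq by (simp add: algebra_simps inner_commute)
    moreover have "v \<bullet> e = (v \<bullet> (z - y)) / norm (z - y)" for v
      by (simp only: e_def inner_scaleR_right divide_inverse mult.commute)
    then have "2 * (x0 \<bullet> e - y \<bullet> e) = 2 * (x0 \<bullet> (z - y) - y \<bullet> (z - y)) / norm (z - y)"
      by (simp only: diff_divide_distrib[symmetric] times_divide_eq_right)
    ultimately have "2 * (x0 \<bullet> e - y \<bullet> e) = norm (z - y)"
      by (simp add: power2_eq_square)
    then have "hyper_reflection e (x0 \<bullet> e) y = z"
      using False by (simp add: hyper_reflection_def e_def)
    then show ?thesis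
      using plane[OF e, of y] through[OF e] by simp
  qed simp
  \<comment> \<open>The radial profile is read off along a fixed ray from \<open>x0\<close>.\<close>
  obtain b :: 'a where "b \<in> Basis" using nonempty_Basis by blast
  then have "u x = u (x0 + norm (x - x0) *\<^sub>R b)" for x
    by (intro rotation) simp
  then show ?thesis
    unfolding radially_symmetric_about_def
    by (intro exI[of _ x0] exI[of _ "\<lambda>t. u (x0 + t *\<^sub>R b)"]) blast
qed

end

theorem theorem4p6:
  fixes u :: "real ^ 'n \<Rightarrow> real" and c s p :: real
  assumes "CARD('n) \<ge> 2"
    and "s \<in> {0<..<1}"
    and "CARD('n) > 2 \<Longrightarrow> p \<in> {1<..<(real CARD('n) + 2) / (real CARD('n) - 2)}"
    and "CARD('n) = 2 \<Longrightarrow> p \<in> {1<..}"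
    and "c > 0"
    and "classical_positive_solution c s p u"
    and "(u \<longlongrightarrow> 0) at_infinity"
  shows "\<exists>x0. radially_symmetric_about x0 u"
proof -
  have "1 < p"
    using assms(1,3,4) by (cases "CARD('n) = 2") auto
  then interpret decaying_solution u c s p
    using assms by unfold_locales auto
  show ?thesis
    by (rule radially_symmetric)
qed

end
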